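(* Let $N>1$, let $\mathcal{X}\subseteq\mathbb{R}^N$ be a finite set, and let $f_e:\mathbb{R}^N\to\mathbb{R}$ (encoder) and $f_d:\mathbb{R}\to\mathbb{R}^N$ (decoder) be Lipschitz continuous with constants $K_e>0$ and $K_d>0$ respectively, where $K_eK_d\ge 1$. Assume that there is a constant $B\ge 0$ with $\|\bm{x}-f_d(f_e(\bm{x}))\|\le B$ for all $\bm{x}\in\mathcal{X}$, and that for every $\bm{x}\in\mathcal{X}$ there exists at least one $h^*\in\mathbb{R}$ with $f_d(h^* )=\bm{x}$. Let $\bm{x_i},\bm{x_j}\in\mathcal{X}$ be two distinct points, and let $h_i=f_e(\bm{x_i})$ and $h_j=f_e(\bm{x_j})$. If $\|\bm{x_i}-\bm{x_j}\|\ge D$ for a constant $D$ with $D\ge 2B$, then $$|h_i-h_j|\ \ge\ \frac{D-2B}{K_d}.$$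
   Context: $\|\cdot\|$ is the Euclidean norm on $\mathbb{R}^N$. A map $f$ is Lipschitz continuous with constant $K$ if $\|f(u)-f(v)\|\le K\|u-v\|$ for all $u,v$ in its domain. The value $h_i=f_e(\bm{x_i})$ is called the latent representation of $\bm{x_i}$, and $\hat{\bm{x_i}}=f_d(h_i)$ its reconstruction. *)

theory Defs
  imports "HOL-Analysis.Analysis"
begin

end

theory Submission
  imports Defs
begin

text \<open>Reconstruction moves each point by at most \<open>B\<close>, so two points at distance
  at least \<open>D\<close> have reconstructions at distance at least \<open>D - 2 * B\<close>. The
  decoder stretches distances by a factor of at most \<open>K_d\<close>, so the latent values must
  already be at least \<open>(D - 2 * B) / K_d\<close> apart.\<close>

theorem theoremC2:
  fixes X :: "(real ^ 'n) set"
    and f_e :: "real ^ 'n \<Rightarrow> real"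
    and f_d :: "real \<Rightarrow> real ^ 'n"
    and K_e K_d B D h_i h_j :: real
    and x_i x_j :: "real ^ 'n"
  assumes "CARD('n) > 1"
    and "finite X"
    and "K_e > 0" and "K_e-lipschitz_on UNIV f_e"
    and "K_d > 0" and "K_d-lipschitz_on UNIV f_d"
    and "K_e * K_d \<ge> 1"
    and "B \<ge> 0" and "\<And>x. x \<in> X \<Longrightarrow> norm (x - f_d (f_e x)) \<le> B"
    and "\<And>x. x \<in> X \<Longrightarrow> \<exists>h. f_d h = x"
    and "x_i \<in> X" and "x_j \<in> X" and "x_i \<noteq> x_j"
    and "h_i = f_e x_i" and "h_j = f_e x_j"
    and "D \<ge> 2 * B" and "norm (x_i - x_j) \<ge> D"
  shows "\<bar>h_i - h_j\<bar> \<ge> (D - 2 * B) / K_d"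
proof -
  let ?y_i = "f_d h_i" and ?y_j = "f_d h_j"
  have "D \<le> dist x_i x_j"
    using \<open>norm (x_i - x_j) \<ge> D\<close> by (simp add: dist_norm)
  \<comment> \<open>The path from \<open>x_i\<close> to \<open>x_j\<close> detours through both
    reconstructions, as only between these does the decoder control the distance.\<close>
  also have "\<dots> \<le> dist x_i ?y_i + dist ?y_i ?y_j + dist x_j ?y_j"
    using dist_triangle[of x_i x_j ?y_i] dist_triangle[of ?y_i x_j ?y_j]
    by (simp add: dist_commute)
  \<comment> \<open>The outer legs are the reconstruction errors of the two points; the middle leg
    joins two decoder values, so the Lipschitz bound turns it into a latent distance.\<close>
  also have "\<dots> \<le> B + K_d * \<bar>h_i - h_j\<bar> + B"
  proof (intro add_mono)
    show "dist x_i ?y_i \<le> B" "dist x_j ?y_j \<le> B"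
      using assms(9)[OF \<open>x_i \<in> X\<close>] assms(9)[OF \<open>x_j \<in> X\<close>] assms(14,15)
      by (simp_all add: dist_norm)
    show "dist ?y_i ?y_j \<le> K_d * \<bar>h_i - h_j\<bar>"
      using lipschitz_onD[OF \<open>K_d-lipschitz_on UNIV f_d\<close>, of h_i h_j]
      by (simp add: dist_real_def)
  qed
  finally show ?thesis
    using \<open>K_d > 0\<close> by (simp add: pos_divide_le_eq mult.commute)
qed

end
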